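(* Let $\mathbf{B}$ be a category, let $\mathbf{C},\mathbf{D},\mathbf{R}$ be concrete categories over $\mathbf{B}$, and let $\gamma:\mathbf{D}\to\mathbf{C}$ and $F:\mathbf{D}\to\mathbf{R}$ be concrete functors. Suppose that $\gamma$ has a weak left adjoint $\langle\alpha,\eta\rangle$ and that $\mathbf{R}$ is fibred. Define the lifting of $F$ on objects $A$ of $\mathbf{C}$ by $\overline{F}(A) := \eta_A^{-1}(F(\alpha(A)))$. Then $\overline{F}$ is a concrete functor from $\mathbf{C}$ to $\mathbf{R}$; that is, $\phi_{\mathbf{R}}(\overline{F}(A))=\phi_{\mathbf{C}}(A)$ for every object $A$ of $\mathbf{C}$, for all objects $A,B$ of $\mathbf{C}$ and every $f\in\mathbf{B}(\phi_{\mathbf{C}}(A),\phi_{\mathbf{C}}(B))$, if $A\Vdash_f B$ then $\overline{F}(A)\Vdash_f\overline{F}(B)$, and the assignment sending each arrow $g\in\mathbf{C}(A,B)$ to the unique arrow $g'\in\mathbf{R}(\overline{F}(A),\overline{F}(B))$ with $\phi_{\mathbf{R}}(g')=\phi_{\mathbf{C}}(g)$ makes $\overline{F}$ a functor with $\phi_{\mathbf{C}}=\phi_{\mathbf{R}}\circ\overline{F}$.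
   Context: A concrete category over a category $\mathbf{B}$ is a category $\mathbf{C}$ together with a faithful functor $\phi_{\mathbf{C}}:\mathbf{C}\to\mathbf{B}$. For objects $A,B$ of $\mathbf{C}$ and $f\in\mathbf{B}(\phi_{\mathbf{C}}(A),\phi_{\mathbf{C}}(B))$, write $A\Vdash_f B$ if there is an arrow $g\in\mathbf{C}(A,B)$ with $\phi_{\mathbf{C}}(g)=f$ (such $g$ is unique). A functor $F:\mathbf{C}\to\mathbf{D}$ between concrete categories over $\mathbf{B}$ is concrete if $\phi_{\mathbf{C}}=\phi_{\mathbf{D}}\circ F$. Weak left adjoint: for a concrete functor $\gamma:\mathbf{D}\to\mathbf{C}$, a weak left adjoint of $\gamma$ is a pair $\langle\alpha,\eta\rangle$ where $\alpha$ assigns to every object $A$ of $\mathbf{C}$ an object $\alpha(A)$ of $\mathbf{D}$ ($\alpha$ need not be a functor), and $\eta$ assigns to every object $A$ of $\mathbf{C}$ an arrow $\eta_A\in\mathbf{B}(\phi_{\mathbf{C}}(A),\phi_{\mathbf{D}}(\alpha(A)))$, such that (1) $A\Vdash_{\eta_A}\gamma(\alpha(A))$, and (2) for every object $K$ of $\mathbf{D}$ and every $f\in\mathbf{B}(\phi_{\mathbf{C}}(A),\phi_{\mathbf{D}}(K))$ with $A\Vdash_f\gamma(K)$, there is an arrow $\overline{f}\in\mathbf{B}(\phi_{\mathbf{D}}(\alpha(A)),\phi_{\mathbf{D}}(K))$ (not necessarily unique) with $\alpha(A)\Vdash_{\overline{f}}K$ and $f=\overline{f}\circ\eta_A$. Cartesian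 arrows: let $\mathbf{C}$ be concrete over $\mathbf{B}$, $B$ an object of $\mathbf{C}$, and $f:X\to\phi_{\mathbf{C}}(B)$ an arrow of $\mathbf{B}$. An arrow $u\in\mathbf{C}(A,B)$ is cartesian (for $f$ and $B$) if $\phi_{\mathbf{C}}(A)=X$, $\phi_{\mathbf{C}}(u)=f$, and for every object $Z$ of $\mathbf{C}$ and every arrow $h:\phi_{\mathbf{C}}(Z)\to X$ of $\mathbf{B}$ with $Z\Vdash_{f\circ h}B$, we have $Z\Vdash_h A$. A concrete category $\mathbf{C}$ is fibred if every object $B$ and every arrow $f:X\to\phi_{\mathbf{C}}(B)$ of $\mathbf{B}$ has a cartesian arrow, and compositions of cartesian arrows are cartesian. For a fibred category a canonical choice of cartesian arrow for each $f$ and $B$ is fixed, and its domain is denoted $f^{-1}(B)$. *)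

theory Defs
  imports Main
begin

section \<open>Categories and functors\<close>

text \<open>
  Structures are carried by sets inside types; the components have no meaning outside the carriers
  (\<open>Comp K g f\<close>, the composite \<open>g \<circ> f\<close>, is meaningful only when \<open>Cod K f = Dom K g\<close>).
\<close>

record ('o, 'a) category =
  Obj :: "'o set"
  Arr :: "'a set"
  Dom :: "'a \<Rightarrow> 'o"
  Cod :: "'a \<Rightarrow> 'o"
  Ident :: "'o \<Rightarrow> 'a"
  Comp :: "'a \<Rightarrow> 'a \<Rightarrow> 'a"

definition hom :: "('o, 'a, 'z) category_scheme \<Rightarrow> 'o \<Rightarrow> 'o \<Rightarrow> 'a set" where
  "hom K X Y = {f \<in> Arr K. Dom K f = X \<and> Cod K f = Y}"

definition is_category :: "('o, 'a, 'z) category_scheme \<Rightarrow> bool" where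
  "is_category K \<longleftrightarrow>
     (\<forall>f\<in>Arr K. Dom K f \<in> Obj K \<and> Cod K f \<in> Obj K) \<and>
     (\<forall>X\<in>Obj K. Ident K X \<in> hom K X X) \<and>
     (\<forall>X\<in>Obj K. \<forall>Y\<in>Obj K. \<forall>Z\<in>Obj K. \<forall>f\<in>hom K X Y. \<forall>g\<in>hom K Y Z.
        Comp K g f \<in> hom K X Z) \<and>
     (\<forall>X\<in>Obj K. \<forall>Y\<in>Obj K. \<forall>f\<in>hom K X Y.
        Comp K f (Ident K X) = f \<and> Comp K (Ident K Y) f = f) \<and>
     (\<forall>W\<in>Obj K. \<forall>X\<in>Obj K. \<forall>Y\<in>Obj K. \<forall>Z\<in>Obj K.
        \<forall>f\<in>hom K W X. \<forall>g\<in>hom K X Y. \<forall>h\<in>hom K Y Z.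
        Comp K h (Comp K g f) = Comp K (Comp K h g) f)"

record ('o1, 'a1, 'o2, 'a2) functor_map =
  on_obj :: "'o1 \<Rightarrow> 'o2"
  on_arr :: "'a1 \<Rightarrow> 'a2"

definition is_functor ::
  "('o1, 'a1, 'y) category_scheme \<Rightarrow> ('o2, 'a2, 'z) category_scheme
    \<Rightarrow> ('o1, 'a1, 'o2, 'a2) functor_map \<Rightarrow> bool" where
  "is_functor K L F \<longleftrightarrow>
     (\<forall>X\<in>Obj K. on_obj F X \<in> Obj L) \<and>
     (\<forall>X\<in>Obj K. \<forall>Y\<in>Obj K. \<forall>f\<in>hom K X Y. on_arr F f \<in> hom L (on_obj F X) (on_obj F Y)) \<and>
     (\<forall>X\<in>Obj K. on_arr F (Ident K X) = Ident L (on_obj F X)) \<and>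
     (\<forall>X\<in>Obj K. \<forall>Y\<in>Obj K. \<forall>Z\<in>Obj K. \<forall>f\<in>hom K X Y. \<forall>g\<in>hom K Y Z.
        on_arr F (Comp K g f) = Comp L (on_arr F g) (on_arr F f))"

definition faithful ::
  "('o1, 'a1, 'y) category_scheme \<Rightarrow> ('o1, 'a1, 'o2, 'a2) functor_map \<Rightarrow> bool" where
  "faithful K F \<longleftrightarrow> (\<forall>X\<in>Obj K. \<forall>Y\<in>Obj K. inj_on (on_arr F) (hom K X Y))"

definition functor_comp ::
  "('o2, 'a2, 'o3, 'a3) functor_map \<Rightarrow> ('o1, 'a1, 'o2, 'a2) functor_map
    \<Rightarrow> ('o1, 'a1, 'o3, 'a3) functor_map" where
  "functor_comp G F = \<lparr>on_obj = on_obj G \<circ> on_obj F, on_arr = on_arr G \<circ> on_arr F\<rparr>"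

text \<open>
  Equality of functors is equality on the carriers of the source category, not HOL equality of the
  underlying total functions.
\<close>

definition functor_eq ::
  "('o1, 'a1, 'y) category_scheme \<Rightarrow> ('o1, 'a1, 'o2, 'a2) functor_map
    \<Rightarrow> ('o1, 'a1, 'o2, 'a2) functor_map \<Rightarrow> bool" where
  "functor_eq K F G \<longleftrightarrow>
     (\<forall>X\<in>Obj K. on_obj F X = on_obj G X) \<and> (\<forall>f\<in>Arr K. on_arr F f = on_arr G f)"

section \<open>Concrete categories\<close>

record ('o, 'a, 'ob, 'ab) concrete_category = "('o, 'a) category" +
  forgetful :: "('o, 'a, 'ob, 'ab) functor_map"

abbreviation und_obj :: "('o, 'a, 'ob, 'ab) concrete_category \<Rightarrow> 'o \<Rightarrow> 'ob" where
  "und_obj C \<equiv> on_obj (forgetful C)"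

abbreviation und_arr :: "('o, 'a, 'ob, 'ab) concrete_category \<Rightarrow> 'a \<Rightarrow> 'ab" where
  "und_arr C \<equiv> on_arr (forgetful C)"

definition concrete_over ::
  "('ob, 'ab) category \<Rightarrow> ('o, 'a, 'ob, 'ab) concrete_category \<Rightarrow> bool" where
  "concrete_over B C \<longleftrightarrow>
     is_category C \<and> is_functor C B (forgetful C) \<and> faithful C (forgetful C)"

text \<open>\<open>forces C X f Y\<close> is the relation \<open>X \<tturnstile>\<^sub>f Y\<close> of \<open>C\<close>.\<close>

definition forces ::
  "('o, 'a, 'ob, 'ab) concrete_category \<Rightarrow> 'o \<Rightarrow> 'ab \<Rightarrow> 'o \<Rightarrow> bool" where
  "forces C X f Y \<longleftrightarrow> (\<exists>g\<in>hom C X Y. und_arr C g = f)"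

definition concrete_functor ::
  "('o1, 'a1, 'ob, 'ab) concrete_category \<Rightarrow> ('o2, 'a2, 'ob, 'ab) concrete_category
    \<Rightarrow> ('o1, 'a1, 'o2, 'a2) functor_map \<Rightarrow> bool" where
  "concrete_functor C D F \<longleftrightarrow>
     is_functor C D F \<and> functor_eq C (forgetful C) (functor_comp (forgetful D) F)"

definition weak_left_adjoint ::
  "('ob, 'ab) category \<Rightarrow> ('oc, 'ac, 'ob, 'ab) concrete_category
    \<Rightarrow> ('od, 'ad, 'ob, 'ab) concrete_category \<Rightarrow> ('od, 'ad, 'oc, 'ac) functor_map
    \<Rightarrow> ('oc \<Rightarrow> 'od) \<Rightarrow> ('oc \<Rightarrow> 'ab) \<Rightarrow> bool" where
  "weak_left_adjoint B C D \<gamma> \<alpha> \<eta> \<longleftrightarrow>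
     (\<forall>X\<in>Obj C.
        \<alpha> X \<in> Obj D \<and>
        \<eta> X \<in> hom B (und_obj C X) (und_obj D (\<alpha> X)) \<and>
        forces C X (\<eta> X) (on_obj \<gamma> (\<alpha> X)) \<and>
        (\<forall>K\<in>Obj D. \<forall>f\<in>hom B (und_obj C X) (und_obj D K).
           forces C X f (on_obj \<gamma> K) \<longrightarrow>
           (\<exists>f'\<in>hom B (und_obj D (\<alpha> X)) (und_obj D K).
              forces D (\<alpha> X) f' K \<and> f = Comp B f' (\<eta> X))))"

section \<open>Fibred concrete categories\<close>

text \<open>\<open>cartesian B C f Y u\<close>: the arrow \<open>u\<close> of \<open>C\<close> is cartesian for \<open>f\<close> and \<open>Y\<close>.\<close>

definition cartesian ::
  "('ob, 'ab) category \<Rightarrow> ('o, 'a, 'ob, 'ab) concrete_category \<Rightarrow> 'ab \<Rightarrow> 'o \<Rightarrow> 'a \<Rightarrow> bool" where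
  "cartesian B C f Y u \<longleftrightarrow>
     Y \<in> Obj C \<and> f \<in> hom B (Dom B f) (und_obj C Y) \<and>
     u \<in> hom C (Dom C u) Y \<and> und_obj C (Dom C u) = Dom B f \<and> und_arr C u = f \<and>
     (\<forall>Z\<in>Obj C. \<forall>h\<in>hom B (und_obj C Z) (Dom B f).
        forces C Z (Comp B f h) Y \<longrightarrow> forces C Z h (Dom C u))"

definition fibred ::
  "('ob, 'ab) category \<Rightarrow> ('o, 'a, 'ob, 'ab) concrete_category \<Rightarrow> bool" where
  "fibred B C \<longleftrightarrow>
     (\<forall>Y\<in>Obj C. \<forall>X\<in>Obj B. \<forall>f\<in>hom B X (und_obj C Y). \<exists>u. cartesian B C f Y u) \<and>
     (\<forall>f g Y u v. cartesian B C f Y u \<longrightarrow> cartesian B C g (Dom C u) v \<longrightarrow>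
        cartesian B C (Comp B f g) Y (Comp C u v))"

text \<open>
  A choice \<open>c f Y\<close> of a cartesian arrow for each \<open>f\<close> and \<open>Y\<close>; \<open>inverse_image C c f Y\<close>
  is then the object \<open>f\<^sup>-\<^sup>1(Y)\<close>.
\<close>

definition cartesian_choice ::
  "('ob, 'ab) category \<Rightarrow> ('o, 'a, 'ob, 'ab) concrete_category \<Rightarrow> ('ab \<Rightarrow> 'o \<Rightarrow> 'a) \<Rightarrow> bool" where
  "cartesian_choice B C c \<longleftrightarrow>
     (\<forall>Y\<in>Obj C. \<forall>X\<in>Obj B. \<forall>f\<in>hom B X (und_obj C Y). cartesian B C f Y (c f Y))"

definition inverse_image ::
  "('o, 'a, 'ob, 'ab) concrete_category \<Rightarrow> ('ab \<Rightarrow> 'o \<Rightarrow> 'a) \<Rightarrow> 'ab \<Rightarrow> 'o \<Rightarrow> 'o" where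
  "inverse_image C c f Y = Dom C (c f Y)"

section \<open>The lifting of a concrete functor\<close>

definition lifting_obj ::
  "('or, 'ar, 'ob, 'ab) concrete_category \<Rightarrow> ('ab \<Rightarrow> 'or \<Rightarrow> 'ar)
    \<Rightarrow> ('oc \<Rightarrow> 'od) \<Rightarrow> ('oc \<Rightarrow> 'ab) \<Rightarrow> ('od, 'ad, 'or, 'ar) functor_map \<Rightarrow> 'oc \<Rightarrow> 'or" where
  "lifting_obj R c \<alpha> \<eta> F X = inverse_image R c (\<eta> X) (on_obj F (\<alpha> X))"

definition lifting ::
  "('oc, 'ac, 'ob, 'ab) concrete_category \<Rightarrow> ('or, 'ar, 'ob, 'ab) concrete_category
    \<Rightarrow> ('ab \<Rightarrow> 'or \<Rightarrow> 'ar) \<Rightarrow> ('oc \<Rightarrow> 'od) \<Rightarrow> ('oc \<Rightarrow> 'ab)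
    \<Rightarrow> ('od, 'ad, 'or, 'ar) functor_map \<Rightarrow> ('oc, 'ac, 'or, 'ar) functor_map" where
  "lifting C R c \<alpha> \<eta> F =
     \<lparr>on_obj = lifting_obj R c \<alpha> \<eta> F,
      on_arr = (\<lambda>g. THE g'.
        g' \<in> hom R (lifting_obj R c \<alpha> \<eta> F (Dom C g)) (lifting_obj R c \<alpha> \<eta> F (Cod C g)) \<and>
        und_arr R g' = und_arr C g)\<rparr>"

end

(* If f underlies an arrow from X to Y in C, then \<eta> Y \<circ> f factors as f' \<circ> \<eta> X with
   f' underlying an arrow \<alpha> X \<rightarrow> \<alpha> Y in D.  Applying F to that arrow and composing with the cartesian
   arrow over \<eta> X gives an arrow over \<eta> Y \<circ> f into F (\<alpha> Y), so f lifts through the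
   cartesian arrow over \<eta> Y.  Functoriality is then forced by faithfulness. *)

theory Submission
  imports Defs
begin

text \<open>\<open>hom\<close> does not ask its endpoints to be objects, whereas the axioms in
  \<open>is_category\<close> and \<open>is_functor\<close> quantify over objects; an arrow between
  the endpoints supplies the missing memberships.\<close>

lemma hom_objD:
  assumes "is_category K" "f \<in> hom K X Y"
  shows "X \<in> Obj K" "Y \<in> Obj K"
  using assms unfolding is_category_def hom_def by blast+

lemma Ident_hom: "is_category K \<Longrightarrow> X \<in> Obj K \<Longrightarrow> Ident K X \<in> hom K X X"
  unfolding is_category_def by blast

lemma Comp_hom:
  assumes "is_category K" "f \<in> hom K X Y" "g \<in> hom K Y Z"
  shows "Comp K g f \<in> hom K X Z"
  using assms hom_objD[OF assms(1,2)] hom_objD[OF assms(1,3)]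
  unfolding is_category_def by blast

lemma functor_Comp:
  assumes "is_category K" "is_functor K L F" "f \<in> hom K X Y" "g \<in> hom K Y Z"
  shows "on_arr F (Comp K g f) = Comp L (on_arr F g) (on_arr F f)"
  using assms hom_objD[OF assms(1,3)] hom_objD[OF assms(1,4)]
  unfolding is_functor_def by blast

lemma und_arr_hom:
  assumes "concrete_over B C" "g \<in> hom C X Y"
  shows "und_arr C g \<in> hom B (und_obj C X) (und_obj C Y)"
proof -
  have "is_category C" "is_functor C B (forgetful C)"
    using assms(1) unfolding concrete_over_def by blast+
  then show ?thesis
    using assms(2) hom_objD[of C g X Y] unfolding is_functor_def by blast
qed

lemma und_obj_in:
  "concrete_over B C \<Longrightarrow> X \<in> Obj C \<Longrightarrow> und_obj C X \<in> Obj B"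
  unfolding concrete_over_def is_functor_def by blast

lemma und_arr_inj:
  assumes "concrete_over B C" "g \<in> hom C X Y" "h \<in> hom C X Y" "und_arr C g = und_arr C h"
  shows "g = h"
proof -
  have "is_category C" "faithful C (forgetful C)"
    using assms(1) unfolding concrete_over_def by blast+
  then have "inj_on (und_arr C) (hom C X Y)"
    using assms(2) hom_objD[of C g X Y] unfolding faithful_def by blast
  then show ?thesis
    using assms(2-4) by (simp add: inj_on_def)
qed

lemma und_arr_Comp:
  assumes "concrete_over B C" "f \<in> hom C X Y" "g \<in> hom C Y Z"
  shows "und_arr C (Comp C g f) = Comp B (und_arr C g) (und_arr C f)"
  using assms(1) functor_Comp[OF _ _ assms(2,3)] unfolding concrete_over_def by blast

text \<open>Witnessing arrows compose in \<open>C\<close>, and the forgetful functor preserves the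
  composite.\<close>

lemma forces_Comp:
  assumes "concrete_over B C" "forces C X f Y" "forces C Y g Z"
  shows "forces C X (Comp B g f) Z"
proof -
  obtain f' g' where "f' \<in> hom C X Y" "und_arr C f' = f" "g' \<in> hom C Y Z" "und_arr C g' = g"
    using assms(2,3) unfolding forces_def by blast
  moreover have "is_category C"
    using assms(1) unfolding concrete_over_def by blast
  ultimately show ?thesis
    using und_arr_Comp[OF assms(1)] Comp_hom[of C f' X Y g' Z] unfolding forces_def by blast
qed

lemma concrete_functor_und_obj:
  "concrete_functor D R F \<Longrightarrow> X \<in> Obj D \<Longrightarrow> und_obj R (on_obj F X) = und_obj D X"
  unfolding concrete_functor_def functor_eq_def functor_comp_def by simp

lemma concrete_functor_on_obj:
  "concrete_functor D R F \<Longrightarrow> X \<in> Obj D \<Longrightarrow> on_obj F X \<in> Obj R"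
  unfolding concrete_functor_def is_functor_def by blast

text \<open>The image under \<open>F\<close> of a witness is again a witness, since concreteness
  keeps its underlying arrow.\<close>

lemma concrete_functor_forces:
  assumes "concrete_functor D R F" "X \<in> Obj D" "Y \<in> Obj D" "forces D X f Y"
  shows "forces R (on_obj F X) f (on_obj F Y)"
proof -
  obtain g where g: "g \<in> hom D X Y" "und_arr D g = f"
    using assms(4) unfolding forces_def by blast
  have "on_arr F g \<in> hom R (on_obj F X) (on_obj F Y)"
    using assms(1-3) g(1) unfolding concrete_functor_def is_functor_def by blast
  moreover have "und_arr R (on_arr F g) = f"
    using assms(1) g unfolding concrete_functor_def functor_eq_def functor_comp_def hom_def by simp
  ultimately show ?thesis
    unfolding forces_def by blast
qed

text \<open>Uniqueness is faithfulness. This makes the definite description in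
  \<open>lifting\<close> meaningful.\<close>

lemma forces_ex1:
  assumes "concrete_over B C" "forces C X f Y"
  shows "\<exists>!g. g \<in> hom C X Y \<and> und_arr C g = f"
  using assms und_arr_inj[OF assms(1)] unfolding forces_def by metis

text \<open>Both functor laws equate parallel arrows of \<open>R\<close>, so faithfulness reduces
  them to equations in \<open>B\<close>, where they follow because the forgetful functors of
  \<open>C\<close> and \<open>R\<close> preserve identities and composites.\<close>

lemma concrete_functorI:
  assumes C: "concrete_over B C" and R: "concrete_over B R"
    and obj: "\<And>X. X \<in> Obj C \<Longrightarrow> on_obj G X \<in> Obj R"
    and und: "\<And>X. X \<in> Obj C \<Longrightarrow> und_obj R (on_obj G X) = und_obj C X"
    and arr: "\<And>X Y g. g \<in> hom C X Y \<Longrightarrow>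
      on_arr G g \<in> hom R (on_obj G X) (on_obj G Y) \<and> und_arr R (on_arr G g) = und_arr C g"
  shows "concrete_functor C R G"
proof -
  have cC: "is_category C" and fC: "is_functor C B (forgetful C)"
    and cR: "is_category R" and fR: "is_functor R B (forgetful R)"
    using C R unfolding concrete_over_def by blast+
  have ident: "on_arr G (Ident C X) = Ident R (on_obj G X)" if X: "X \<in> Obj C" for X
  proof (rule und_arr_inj[OF R])
    have "und_arr C (Ident C X) = Ident B (und_obj C X)"
      using fC X unfolding is_functor_def by blast
    also have "\<dots> = und_arr R (Ident R (on_obj G X))"
      using fR obj[OF X] und[OF X] unfolding is_functor_def by simp
    finally show "und_arr R (on_arr G (Ident C X)) = und_arr R (Ident R (on_obj G X))"
      using arr[OF Ident_hom[OF cC X]] by simp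
  qed (use arr[OF Ident_hom[OF cC X]] Ident_hom[OF cR obj[OF X]] in blast)+
  have comp: "on_arr G (Comp C g f) = Comp R (on_arr G g) (on_arr G f)"
    if f: "f \<in> hom C X Y" and g: "g \<in> hom C Y Z" for X Y Z f g
  proof (rule und_arr_inj[OF R])
    \<comment> \<open>Both sides lie over \<open>Comp B (und_arr C g) (und_arr C f)\<close>.\<close>
    show "und_arr R (on_arr G (Comp C g f)) = und_arr R (Comp R (on_arr G g) (on_arr G f))"
      using arr[OF Comp_hom[OF cC f g]] arr[OF f] arr[OF g]
        und_arr_Comp[OF C f g] und_arr_Comp[OF R, of "on_arr G f" _ _ "on_arr G g"]
      by metis
    show "on_arr G (Comp C g f) \<in> hom R (on_obj G X) (on_obj G Z)"
      using arr[OF Comp_hom[OF cC f g]] by blast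
    show "Comp R (on_arr G g) (on_arr G f) \<in> hom R (on_obj G X) (on_obj G Z)"
      using arr[OF f] arr[OF g] Comp_hom[OF cR] by blast
  qed
  have "is_functor C R G"
    unfolding is_functor_def using obj arr ident comp by blast
  moreover have "functor_eq C (forgetful C) (functor_comp (forgetful R) G)"
    unfolding functor_eq_def functor_comp_def using und arr by (simp add: hom_def)
  ultimately show ?thesis
    unfolding concrete_functor_def by blast
qed

lemma cartesian_forces:
  "cartesian B C f Y u \<Longrightarrow> forces C (Dom C u) f Y"
  unfolding cartesian_def forces_def by blast

lemma cartesian_dom:
  assumes "is_category C" "cartesian B C f Y u" "f \<in> hom B X Y'"
  shows "Dom C u \<in> Obj C" "und_obj C (Dom C u) = X"
  using assms hom_objD[of C u "Dom C u" Y] unfolding cartesian_def hom_def by auto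

text \<open>The universal property with \<open>Dom B f\<close> replaced by the equal object
  \<open>und_obj C (Dom C u)\<close>, the form in which the underlying object of a lifted object
  appears.\<close>

lemma cartesian_lift:
  assumes "cartesian B C f Y u" "Z \<in> Obj C" "h \<in> hom B (und_obj C Z) (und_obj C (Dom C u))"
    "forces C Z (Comp B f h) Y"
  shows "forces C Z h (Dom C u)"
  using assms unfolding cartesian_def by auto

text \<open>Concreteness places \<open>on_obj F (\<alpha> X)\<close> over the same object of
  \<open>B\<close> as \<open>\<alpha> X\<close>, so \<open>\<eta> X\<close> is an arrow to which the
  choice \<open>c\<close> applies.\<close>

lemma lifting_cartesian:
  assumes "concrete_over B C" "concrete_functor D R F"
    "weak_left_adjoint B C D \<gamma> \<alpha> \<eta>" "cartesian_choice B R c" "X \<in> Obj C"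
  shows "cartesian B R (\<eta> X) (on_obj F (\<alpha> X)) (c (\<eta> X) (on_obj F (\<alpha> X)))"
proof -
  have aX: "\<alpha> X \<in> Obj D" and "\<eta> X \<in> hom B (und_obj C X) (und_obj D (\<alpha> X))"
    using assms(3,5) unfolding weak_left_adjoint_def by blast+
  then have "\<eta> X \<in> hom B (und_obj C X) (und_obj R (on_obj F (\<alpha> X)))"
    using concrete_functor_und_obj[OF assms(2)] by simp
  then show ?thesis
    using assms(4) concrete_functor_on_obj[OF assms(2) aX] und_obj_in[OF assms(1,5)]
    unfolding cartesian_choice_def by blast
qed

lemma lifting_obj_in:
  assumes "concrete_over B C" "concrete_over B R" "concrete_functor D R F"
    "weak_left_adjoint B C D \<gamma> \<alpha> \<eta>" "cartesian_choice B R c" "X \<in> Obj C"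
  shows "lifting_obj R c \<alpha> \<eta> F X \<in> Obj R"
    and "und_obj R (lifting_obj R c \<alpha> \<eta> F X) = und_obj C X"
proof -
  have "is_category R" "\<eta> X \<in> hom B (und_obj C X) (und_obj D (\<alpha> X))"
    using assms(2,4,6) unfolding concrete_over_def weak_left_adjoint_def by blast+
  then show "lifting_obj R c \<alpha> \<eta> F X \<in> Obj R"
    and "und_obj R (lifting_obj R c \<alpha> \<eta> F X) = und_obj C X"
    using cartesian_dom[OF _ lifting_cartesian[OF assms(1,3-6)]]
    unfolding lifting_obj_def inverse_image_def by blast+
qed

text \<open>Phrased through \<open>forces\<close> because the weak adjunction and the cartesian
  property both speak of arrows of \<open>B\<close> that lift, not of the lifts themselves.\<close>

lemma lifting_obj_forces:
  assumes B: "is_category B" and C: "concrete_over B C" and R: "concrete_over B R"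
    and F: "concrete_functor D R F" and adj: "weak_left_adjoint B C D \<gamma> \<alpha> \<eta>"
    and c: "cartesian_choice B R c"
    and X: "X \<in> Obj C" and Y: "Y \<in> Obj C" and f: "forces C X f Y"
  shows "forces R (lifting_obj R c \<alpha> \<eta> F X) f (lifting_obj R c \<alpha> \<eta> F Y)"
proof -
  have fB: "f \<in> hom B (und_obj C X) (und_obj C Y)"
    using f und_arr_hom[OF C] unfolding forces_def by blast
  have aX: "\<alpha> X \<in> Obj D" and aY: "\<alpha> Y \<in> Obj D"
    and eY: "\<eta> Y \<in> hom B (und_obj C Y) (und_obj D (\<alpha> Y))"
    and fY: "forces C Y (\<eta> Y) (on_obj \<gamma> (\<alpha> Y))"
    using adj X Y unfolding weak_left_adjoint_def by blast+
  \<comment> \<open>The weak universal property of \<open>\<alpha> X\<close> is applied with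
    \<open>K\<close> equal to \<open>\<alpha> Y\<close> and to the composite
    \<open>Comp B (\<eta> Y) f\<close>, which lifts to \<open>C\<close> by
    \<open>forces_Comp\<close>.\<close>
  obtain f' where f': "forces D (\<alpha> X) f' (\<alpha> Y)" "Comp B (\<eta> Y) f = Comp B f' (\<eta> X)"
    using adj X aY Comp_hom[OF B fB eY] forces_Comp[OF C f fY]
    unfolding weak_left_adjoint_def by blast
  note cart = lifting_cartesian[OF C F adj c]
  \<comment> \<open>The chosen cartesian arrow over \<open>\<eta> X\<close> is followed by the image
    under \<open>F\<close> of a witness for \<open>f'\<close>.\<close>
  have "forces R (lifting_obj R c \<alpha> \<eta> F X) (Comp B f' (\<eta> X)) (on_obj F (\<alpha> Y))"
    unfolding lifting_obj_def inverse_image_def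
    using forces_Comp[OF R cartesian_forces[OF cart[OF X]]
        concrete_functor_forces[OF F aX aY f'(1)]] .
  \<comment> \<open>By the factorization this composite lies over
    \<open>Comp B (\<eta> Y) f\<close>, so the cartesian arrow over \<open>\<eta> Y\<close> lifts
    \<open>f\<close>; \<open>lifting_obj_in\<close> identifies the underlying objects so that
    \<open>fB\<close> has the required type.\<close>
  then show ?thesis
    using cartesian_lift[OF cart[OF Y]] fB f'(2)
      lifting_obj_in[OF C R F adj c X] lifting_obj_in[OF C R F adj c Y]
    unfolding lifting_obj_def inverse_image_def by simp
qed

theorem theorem1:
  fixes B :: "('ob, 'ab) category"
    and C :: "('oc, 'ac, 'ob, 'ab) concrete_category"
    and D :: "('od, 'ad, 'ob, 'ab) concrete_category"
    and R :: "('or, 'ar, 'ob, 'ab) concrete_category"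
    and \<gamma> :: "('od, 'ad, 'oc, 'ac) functor_map"
    and F :: "('od, 'ad, 'or, 'ar) functor_map"
    and \<alpha> :: "'oc \<Rightarrow> 'od" and \<eta> :: "'oc \<Rightarrow> 'ab"
    and c :: "'ab \<Rightarrow> 'or \<Rightarrow> 'ar"
  assumes "is_category B"
    and "concrete_over B C" and "concrete_over B D" and "concrete_over B R"
    and "concrete_functor D C \<gamma>" and "concrete_functor D R F"
    and "weak_left_adjoint B C D \<gamma> \<alpha> \<eta>"
    and "fibred B R" and "cartesian_choice B R c"
  defines "Fbar \<equiv> lifting C R c \<alpha> \<eta> F"
  shows "(\<forall>X\<in>Obj C. on_obj Fbar X \<in> Obj R \<and> und_obj R (on_obj Fbar X) = und_obj C X) \<and>
    (\<forall>X\<in>Obj C. \<forall>Y\<in>Obj C. \<forall>f\<in>hom B (und_obj C X) (und_obj C Y).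
       forces C X f Y \<longrightarrow> forces R (on_obj Fbar X) f (on_obj Fbar Y)) \<and>
    (\<forall>X\<in>Obj C. \<forall>Y\<in>Obj C. \<forall>g\<in>hom C X Y.
       (\<exists>!g'. g' \<in> hom R (on_obj Fbar X) (on_obj Fbar Y) \<and> und_arr R g' = und_arr C g) \<and>
       on_arr Fbar g \<in> hom R (on_obj Fbar X) (on_obj Fbar Y) \<and>
       und_arr R (on_arr Fbar g) = und_arr C g) \<and>
    concrete_functor C R Fbar"
proof -
  note B = assms(1) and C = assms(2) and R = assms(4) and F = assms(6) and adj = assms(7) and c = assms(9)
  have on_obj: "on_obj Fbar = lifting_obj R c \<alpha> \<eta> F"
    unfolding Fbar_def lifting_def by simp
  have obj: "on_obj Fbar X \<in> Obj R" "und_obj R (on_obj Fbar X) = und_obj C X"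
    if "X \<in> Obj C" for X
    using lifting_obj_in[OF C R F adj c that] unfolding on_obj by blast+
  have forces: "forces R (on_obj Fbar X) f (on_obj Fbar Y)"
    if "X \<in> Obj C" "Y \<in> Obj C" "forces C X f Y" for X Y f
    using lifting_obj_forces[OF B C R F adj c that] unfolding on_obj .
  have ex1: "\<exists>!g'. g' \<in> hom R (on_obj Fbar X) (on_obj Fbar Y) \<and> und_arr R g' = und_arr C g"
    if g: "g \<in> hom C X Y" for X Y g
  proof -
    have "X \<in> Obj C" "Y \<in> Obj C"
      using C hom_objD[OF _ g] unfolding concrete_over_def by blast+
    moreover have "forces C X (und_arr C g) Y"
      using g unfolding forces_def by blast
    ultimately show ?thesis
      using forces_ex1[OF R] forces by blast
  qed
  have arr: "on_arr Fbar g \<in> hom R (on_obj Fbar X) (on_obj Fbar Y) \<and>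
      und_arr R (on_arr Fbar g) = und_arr C g"
    if g: "g \<in> hom C X Y" for X Y g
  proof -
    \<comment> \<open>The description in \<open>lifting\<close> mentions \<open>Dom C g\<close> and
      \<open>Cod C g\<close>; membership of \<open>g\<close> in \<open>hom C X Y\<close> turns them
      into \<open>X\<close> and \<open>Y\<close>, matching \<open>ex1\<close>.\<close>
    have "on_arr Fbar g =
        (THE g'. g' \<in> hom R (on_obj Fbar X) (on_obj Fbar Y) \<and> und_arr R g' = und_arr C g)"
      using g unfolding on_obj unfolding Fbar_def lifting_def hom_def by simp
    then show ?thesis
      using theI'[OF ex1[OF g]] by simp
  qed
  have "concrete_functor C R Fbar"
    using concrete_functorI[OF C R, of Fbar] obj arr by blast
  then show ?thesis
    using obj forces ex1 arr by blast
qed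

end
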